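(* Let $m\le M$ be real numbers, let $(\vartheta,\mathbf g)$ be an entropy pair with $\vartheta''>0$, and let $h_{ec}$ be the associated entropy conservative flux. Then for all $u^-,u^+\in[m,M]$, all $\mathbf n\in\mathbb R^d\setminus\{0\}$, all $\alpha\ge L_f$ (with $\alpha>0$) and all convex entropy pairs $(\eta,\mathbf q)$, $$m\le\mathcal U(u^-,u^+,\mathbf n):=(1-\beta)u^-+\beta u^+-\frac{h_{ec}(u^-,u^+,\mathbf n)-\mathbf f(u^-)\cdot\mathbf n}{2\alpha|\mathbf n|}\le M,$$ $$\eta\big(\mathcal U(u^-,u^+,\mathbf n)\big)\le\frac{\eta(u^-)+\overline\eta(u^-,u^+)}2-\frac{q_{ec}(u^-,u^+,\mathbf n)-\mathbf q(u^-)\cdot\mathbf n}{2\alpha|\mathbf n|},$$ with, writing $v^\pm=v(u^\pm)=\vartheta'(u^\pm)$, $$\beta=\beta(u^-,u^+)=\frac12\int_0^1\frac{u(\theta v^++(1-\theta)v^-)-u^-}{u^+-u^-}\,d\theta\in\Big(0,\frac12\Big],$$ $$\overline\eta(u^-,u^+)=\int_0^1\eta\circ u\big(\theta v^++(1-\theta)v^-\big)d\theta,\qquad q_{ec}(u^-,u^+,\mathbf n)=\int_0^1\mathbf q\circ u\big(\theta v^++(1-\theta)v^-\big)\cdot\mathbf n\,d\theta.$$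
   Context: $\mathbf f:\mathbb R\to\mathbb R^d$, $d\ge1$, is locally Lipschitz and $L_f=L_f(m,M):=\sup_{m\le u^+\neq u^-\le M}\sup_{\mathbf n\in\mathbb S^{d-1}}\frac{|(\mathbf f(u^+)-\mathbf f(u^-))\cdot\mathbf n|}{|u^+-u^-|}$. A convex entropy pair $(\eta,\mathbf q)$ means $\eta$ convex and $\mathbf q(u)=\int^u\eta'(w)\mathbf f'(w)\,dw$; likewise $\mathbf g(u)=\int^u\vartheta'(w)\mathbf f'(w)\,dw$. $v(u)=\vartheta'(u)$ is the entropy variable, which is strictly increasing, and $u(\cdot)$ denotes its inverse function, $u\mapsto v(u)$, $v\mapsto u(v)$. With $\boldsymbol\psi(u)=v(u)\mathbf f(u)-\mathbf g(u)$, the flux $h_{ec}$ is smooth, consistent ($h_{ec}(u,u,\mathbf n)=\mathbf f(u)\cdot\mathbf n$), symmetric ($h_{ec}(u^-,u^+,\mathbf n)=h_{ec}(u^+,u^-,\mathbf n)$), linear in $\mathbf n\in\mathbb R^d$, and entropy conservative for $(\vartheta,\mathbf g)$: $(v(u^+)-v(u^-))h_{ec}(u^-,u^+,\mathbf n)=(\boldsymbol\psi(u^+)-\boldsymbol\psi(u^-))\cdot\mathbf n$ for all $u^\pm$. When $u^+=u^-=u$, the quotient in $\beta$ is understood as its limit $\theta$, so $\beta(u,u)=\frac14$. *)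

theory Defs
  imports "HOL-Analysis.Analysis"
begin

definition locally_lipschitz :: "(real \<Rightarrow> real^'d) \<Rightarrow> bool" where
  "locally_lipschitz f \<longleftrightarrow> (\<forall>x. \<exists>r>0. \<exists>L. L-lipschitz_on (cball x r) f)"

(* The supremum is extended-real valued: it is over the empty set when m = M. *)
definition flux_lip :: "(real \<Rightarrow> real^'d) \<Rightarrow> real \<Rightarrow> real \<Rightarrow> ereal" where
  "flux_lip f m M =
     (SUP (up, um) \<in> {(up, um). up \<in> {m..M} \<and> um \<in> {m..M} \<and> up \<noteq> um}.
        SUP n \<in> sphere 0 1. ereal (\<bar>(f up - f um) \<bullet> n\<bar> / \<bar>up - um\<bar>))"

(* q is a primitive of eta' f', fixed only up to an additive constant.  A locally Lipschitz f and a
   convex eta are differentiable only almost everywhere; the unspecified values that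
   vector_derivative and deriv take on the exceptional null set do not affect the integral. *)
definition entropy_pair ::
    "(real \<Rightarrow> real^'d) \<Rightarrow> (real \<Rightarrow> real) \<Rightarrow> (real \<Rightarrow> real^'d) \<Rightarrow> bool" where
  "entropy_pair f \<eta> q \<longleftrightarrow>
     (\<forall>a b. a \<le> b \<longrightarrow>
        ((\<lambda>w. deriv \<eta> w *\<^sub>R vector_derivative f (at w)) has_integral (q b - q a)) {a..b})"

definition convex_entropy_pair ::
    "(real \<Rightarrow> real^'d) \<Rightarrow> (real \<Rightarrow> real) \<Rightarrow> (real \<Rightarrow> real^'d) \<Rightarrow> bool" where
  "convex_entropy_pair f \<eta> q \<longleftrightarrow> convex_on UNIV \<eta> \<and> entropy_pair f \<eta> q"

definition has_pos_second_deriv :: "(real \<Rightarrow> real) \<Rightarrow> bool" where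
  "has_pos_second_deriv \<theta> \<longleftrightarrow>
     (\<forall>x. \<theta> field_differentiable at x \<and> deriv \<theta> field_differentiable at x \<and> deriv (deriv \<theta>) x > 0)"

definition entropy_potential ::
    "(real \<Rightarrow> real^'d) \<Rightarrow> (real \<Rightarrow> real) \<Rightarrow> (real \<Rightarrow> real^'d) \<Rightarrow> real \<Rightarrow> real^'d" where
  "entropy_potential f \<theta> g u = deriv \<theta> u *\<^sub>R f u - g u"

(* Consistency makes f as regular as h on the diagonal, so for a merely locally Lipschitz f the
   smoothness required of h in the two states cannot mean differentiability; continuity is the
   requirement imposed here.  Smoothness in n follows from linearity. *)
definition entropy_conservative_flux ::
    "(real \<Rightarrow> real^'d) \<Rightarrow> (real \<Rightarrow> real) \<Rightarrow> (real \<Rightarrow> real^'d)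
      \<Rightarrow> (real \<Rightarrow> real \<Rightarrow> real^'d \<Rightarrow> real) \<Rightarrow> bool" where
  "entropy_conservative_flux f \<theta> g h \<longleftrightarrow>
     (\<forall>n. continuous_on UNIV (\<lambda>(um, up). h um up n)) \<and>
     (\<forall>u n. h u u n = f u \<bullet> n) \<and>
     (\<forall>um up n. h um up n = h up um n) \<and>
     (\<forall>um up. linear (h um up)) \<and>
     (\<forall>um up n. (deriv \<theta> up - deriv \<theta> um) * h um up n
        = (entropy_potential f \<theta> g up - entropy_potential f \<theta> g um) \<bullet> n)"

(* u(s v(up) + (1 - s) v(um)), where v is the derivative of the entropy and u its inverse. *)
definition entropy_path :: "(real \<Rightarrow> real) \<Rightarrow> real \<Rightarrow> real \<Rightarrow> real \<Rightarrow> real" where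
  "entropy_path \<theta> um up s = inv (deriv \<theta>) (s * deriv \<theta> up + (1 - s) * deriv \<theta> um)"

definition beta :: "(real \<Rightarrow> real) \<Rightarrow> real \<Rightarrow> real \<Rightarrow> real" where
  "beta \<theta> um up =
     (1/2) * integral {0..1}
       (\<lambda>s. if up = um then s else (entropy_path \<theta> um up s - um) / (up - um))"

definition eta_bar :: "(real \<Rightarrow> real) \<Rightarrow> (real \<Rightarrow> real) \<Rightarrow> real \<Rightarrow> real \<Rightarrow> real" where
  "eta_bar \<theta> \<eta> um up = integral {0..1} (\<lambda>s. \<eta> (entropy_path \<theta> um up s))"

definition q_ec ::
    "(real \<Rightarrow> real) \<Rightarrow> (real \<Rightarrow> real^'d) \<Rightarrow> real \<Rightarrow> real \<Rightarrow> real^'d \<Rightarrow> real" where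
  "q_ec \<theta> q um up n = integral {0..1} (\<lambda>s. q (entropy_path \<theta> um up s) \<bullet> n)"

definition bar_state ::
    "(real \<Rightarrow> real^'d) \<Rightarrow> (real \<Rightarrow> real) \<Rightarrow> (real \<Rightarrow> real \<Rightarrow> real^'d \<Rightarrow> real)
      \<Rightarrow> real \<Rightarrow> real \<Rightarrow> real \<Rightarrow> real^'d \<Rightarrow> real" where
  "bar_state f \<theta> h \<alpha> um up n =
     (1 - beta \<theta> um up) * um + beta \<theta> um up * up - (h um up n - f um \<bullet> n) / (2 * \<alpha> * norm n)"

end

(* The normalized flux phi = f.n / (alpha |n|) is 1-Lipschitz on [m, M], and the continuity of h_ec
   in the entropy conservation identity makes psi differentiable with respect to v, with derivative f.
   Hence h_ec, like beta, is an average along the path w = u(s v+ + (1 - s) v-), and U is the average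
   over s of the states (u- + w)/2 - (phi(w) - phi(u-))/2.  Each of these is a Lax-Friedrichs
   intermediate state, so it lies in [m, M] and satisfies the entropy inequality between u- and w;
   Jensen's inequality then gives the bound at U.

   That f is the integral of its derivative is not taken from Rademacher's theorem: dividing
   g = int v f' by v and using d psi = f dv shows that f - int f' has derivative 0 wherever v is
   nonzero, that is, at all but at most one point. *)
theory Submission
  imports Defs
begin

section \<open>Locally Lipschitz fluxes and bounds on their derivatives\<close>

lemma abs_derivative_le:
  fixes \<phi> :: "real \<Rightarrow> real"
  assumes "(\<phi> has_real_derivative D) (at x)" "r > 0"
    and "\<And>y. \<bar>y - x\<bar> \<le> r \<Longrightarrow> \<bar>\<phi> y - \<phi> x\<bar> \<le> L * \<bar>y - x\<bar>"
  shows "\<bar>D\<bar> \<le> L"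
proof -
  have lim: "((\<lambda>y. \<bar>(\<phi> y - \<phi> x) / (y - x)\<bar>) \<longlongrightarrow> \<bar>D\<bar>) (at x)"
    using assms(1) by (intro tendsto_rabs) (simp add: has_field_derivative_iff)
  have "\<forall>\<^sub>F y in at x. \<bar>(\<phi> y - \<phi> x) / (y - x)\<bar> \<le> L"
    unfolding eventually_at
  proof (intro exI[of _ r] conjI ballI impI)
    fix y assume "y \<noteq> x \<and> dist y x < r"
    then show "\<bar>(\<phi> y - \<phi> x) / (y - x)\<bar> \<le> L"
      using assms(3)[of y] by (simp add: dist_real_def abs_divide pos_divide_le_eq)
  qed (use assms in auto)
  then show ?thesis
    using lim by (intro tendsto_upperbound[OF lim]) auto
qed

lemma locally_lipschitz_imp_lipschitz_on:
  assumes "locally_lipschitz f" "compact X"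
  obtains L where "L-lipschitz_on X f"
proof -
  \<comment> \<open>\<open>local_lipschitz\<close> concerns time-dependent families; a constant
    family over the single time 0 makes its compactness theorem applicable to
    \<open>f\<close>.\<close>
  have ll: "local_lipschitz {0::real} X (\<lambda>_. f)"
    unfolding local_lipschitz_def
  proof (intro ballI)
    fix x t :: real assume "x \<in> X"
    obtain r L where "r > 0" "L-lipschitz_on (cball x r) f"
      using assms(1) unfolding locally_lipschitz_def by blast
    then show "\<exists>u>0. \<exists>L. \<forall>t\<in>cball t u \<inter> {0}. L-lipschitz_on (cball x u \<inter> X) f"
      by (intro exI[of _ r] conjI exI[of _ L]) (auto intro: lipschitz_on_subset)
  qed
  show ?thesis
    using local_lipschitz_compact_implies_lipschitz[of "{0::real}" X "\<lambda>_. f"] ll assms(2) that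
    by auto
qed

lemma locally_lipschitz_imp_continuous:
  assumes "locally_lipschitz f"
  shows "continuous_on UNIV f"
proof -
  have "isCont f x" for x
  proof -
    obtain r L where "r > 0" "L-lipschitz_on (cball x r) f"
      using assms unfolding locally_lipschitz_def by blast
    then have "continuous_on (ball x r) f"
      using lipschitz_on_continuous_on continuous_on_subset ball_subset_cball by blast
    then show ?thesis
      using \<open>r > 0\<close> by (simp add: continuous_on_eq_continuous_at)
  qed
  then show ?thesis by (simp add: continuous_at_imp_continuous_on)
qed

text \<open>Where \<^term>\<open>f\<close> is not differentiable, \<^term>\<open>vector_derivative f (at w)\<close> is one
  fixed unspecified vector, so that it is bounded there as well.\<close>
lemma vector_derivative_inner_bounded:
  fixes f :: "real \<Rightarrow> real^'d" and N :: "real^'d"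
  assumes "locally_lipschitz f"
  obtains B where "\<And>w. w \<in> {a..b} \<Longrightarrow> \<bar>vector_derivative f (at w) \<bullet> N\<bar> \<le> B"
proof -
  \<comment> \<open>The margin 1 keeps difference quotients with steps up to 1 inside the Lipschitz
    interval, even at the end points of \<open>{a..b}\<close>.\<close>
  obtain L where L: "L-lipschitz_on {a - 1..b + 1} f"
    using locally_lipschitz_imp_lipschitz_on[OF assms] compact_Icc by blast
  define c where "c = (SOME D :: real^'d. False)"
  have "\<bar>vector_derivative f (at w) \<bullet> N\<bar> \<le> max (L * norm N) \<bar>c \<bullet> N\<bar>" if w: "w \<in> {a..b}" for w
  proof (cases "f differentiable at w")
    case True
    then have "(f has_vector_derivative vector_derivative f (at w)) (at w)"
      by (simp add: vector_derivative_works)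
    then have "((\<lambda>x. f x \<bullet> N) has_real_derivative vector_derivative f (at w) \<bullet> N) (at w)"
      unfolding has_real_derivative_iff_has_vector_derivative
      by (rule bounded_linear.has_vector_derivative[OF bounded_linear_inner_left])
    then have "\<bar>vector_derivative f (at w) \<bullet> N\<bar> \<le> L * norm N"
    proof (rule abs_derivative_le)
      fix y assume "\<bar>y - w\<bar> \<le> 1"
      then have "norm (f y - f w) \<le> L * \<bar>y - w\<bar>"
        using lipschitz_onD[OF L, of y w] w by (auto simp: dist_norm abs_le_iff)
      then have "norm (f y - f w) * norm N \<le> L * \<bar>y - w\<bar> * norm N"
        by (rule mult_right_mono) simp
      then show "\<bar>f y \<bullet> N - f w \<bullet> N\<bar> \<le> L * norm N * \<bar>y - w\<bar>"
        using Cauchy_Schwarz_ineq2[of "f y - f w" N] by (simp add: inner_diff_left algebra_simps)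
    qed simp
    then show ?thesis by simp
  next
    case False
    then have "(\<lambda>D. (f has_vector_derivative D) (at w)) = (\<lambda>D. False)"
      using differentiableI_vector by blast
    then have "vector_derivative f (at w) = c"
      by (simp add: vector_derivative_def c_def)
    then show ?thesis by simp
  qed
  then show ?thesis using that by blast
qed

section \<open>Auxiliary facts on integrals and increments\<close>

text \<open>The quotient of the integrable product by \<open>v\<close> is measurable and bounded,
  hence integrable on a bounded interval. It differs from \<open>d\<close> only where
  \<open>v\<close> vanishes, and strict monotonicity leaves at most one zero.\<close>

lemma integrable_cancel_factor:
  fixes v d :: "real \<Rightarrow> real"
  assumes "continuous_on {a..b} v" "strict_mono v"
    and "(\<lambda>w. v w * d w) integrable_on {a..b}"
    and "\<And>w. w \<in> {a..b} \<Longrightarrow> \<bar>d w\<bar> \<le> B"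
  shows "d integrable_on {a..b}"
proof -
  have "(\<lambda>w. v w * d w / v w) \<in> borel_measurable (lebesgue_on {a..b})"
    using integrable_imp_measurable[OF assms(3)] continuous_imp_measurable_on_sets_lebesgue[OF assms(1)]
    by (intro borel_measurable_divide) (auto simp: borel_closed)
  then have "(\<lambda>w. v w * d w / v w) integrable_on {a..b}"
  proof (rule measurable_bounded_by_integrable_imp_integrable)
    \<comment> \<open>At a zero of \<open>v\<close> the quotient has the default value 0, which
      \<open>B\<close> dominates since it bounds an absolute value.\<close>
    show "norm (v w * d w / v w) \<le> B" if "w \<in> {a..b}" for w
      using assms(4)[OF that] by (cases "v w = 0") auto
    show "{a..b} \<in> sets lebesgue"
      by (metis cbox_interval lmeasurable_cbox fmeasurableD)
  qed auto
  then show ?thesis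
  proof (rule integrable_spike)
    have "\<exists>z. {w. v w = 0} \<subseteq> {z}"
      using strict_mono_eq[OF assms(2)] by (metis (mono_tags, lifting) mem_Collect_eq singleton_iff subsetI)
    then show "negligible {w. v w = 0}"
      by (metis negligible_sing negligible_subset)
  qed auto
qed

text \<open>Lebesgue's differentiation theorem: off a null set, \<open>d x\<close> is the limit of
  the averages of \<open>d\<close> over \<open>{x..x + h}\<close>, and these are at most
  \<open>L\<close> in absolute value.\<close>

lemma ae_le_of_integral_le:
  fixes d :: "real \<Rightarrow> real"
  assumes "\<And>x y. d integrable_on {x..y}"
    and "\<And>x y. a \<le> x \<Longrightarrow> x < y \<Longrightarrow> y \<le> b \<Longrightarrow> \<bar>integral {x..y} d\<bar> \<le> L * (y - x)"
  obtains K where "negligible K" "\<And>x. x \<in> {a..b} - K \<Longrightarrow> \<bar>d x\<bar> \<le> L"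
proof -
  obtain K where K: "negligible K"
    "\<And>x e. \<lbrakk>x \<notin> K; 0 < e\<rbrakk> \<Longrightarrow> \<exists>t>0. \<forall>h. 0 < h \<and> h < t \<longrightarrow> norm (integral {x..x + h} d / h - d x) < e"
    using integrable_ccontinuous_explicit[of d] assms(1) by (auto simp: divide_inverse_commute)
  \<comment> \<open>Only right-sided averages are used, so the end point \<open>b\<close>, which has
    none inside the interval, joins the null set.\<close>
  have "\<bar>d x\<bar> \<le> L" if x: "x \<in> {a..b} - insert b K" for x
  proof (rule field_le_epsilon)
    fix e :: real assume "e > 0"
    then obtain t where t: "t > 0"
      "\<And>h. 0 < h \<and> h < t \<Longrightarrow> \<bar>integral {x..x + h} d / h - d x\<bar> < e"
      using K(2)[of x e] x by auto
    define h where "h = min (t / 2) (b - x)"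
    have h: "0 < h" "h < t" "x + h \<le> b"
      using t(1) x by (auto simp: h_def)
    have "\<bar>integral {x..x + h} d / h\<bar> \<le> L"
      using assms(2)[of x "x + h"] h x by (auto simp: abs_divide pos_divide_le_eq)
    then show "\<bar>d x\<bar> \<le> L + e"
      using t(2)[of h] h by linarith
  qed
  then show ?thesis
    using that[of "insert b K"] K(1) by auto
qed

text \<open>On a partition into \<open>n\<close> equal pieces the increments of \<open>E\<close> add
  up to at most \<open>(r b - r a) * (b - a) / n\<close>, because those of \<open>r\<close>
  telescope; this tends to 0. The argument tolerates jumps of \<open>r\<close>.\<close>

lemma eq_if_variation_le_monotone:
  fixes E r :: "real \<Rightarrow> real"
  assumes "a \<le> b" and inc: "\<And>x y. a \<le> x \<Longrightarrow> x \<le> y \<Longrightarrow> y \<le> b \<Longrightarrow> \<bar>E y - E x\<bar> \<le> (r y - r x) * (y - x)"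
  shows "E b = E a"
proof -
  have bound: "\<bar>E b - E a\<bar> \<le> (r b - r a) * (b - a) * inverse (real (Suc k))" for k
  proof -
    define n where "n = Suc k"
    define x where "x i = a + real i * ((b - a) / n)" for i
    have x: "x 0 = a" "x n = b" by (auto simp: x_def n_def)
    have telescope: "(\<Sum>i<n. F (x (Suc i)) - F (x i)) = F b - F a" for F :: "real \<Rightarrow> real"
      using sum_lessThan_telescope[of "\<lambda>i. F (x i)" n] by (simp add: x)
    have step: "x (Suc i) - x i = (b - a) / n" for i
      by (simp add: x_def algebra_simps add_divide_distrib diff_divide_distrib)
    have rng: "a \<le> x i" "x i \<le> b" if "i \<le> n" for i
    proof -
      have "real i * ((b - a) / n) \<le> real n * ((b - a) / n)"
        using that assms(1) by (intro mult_right_mono) auto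
      then show "x i \<le> b" by (simp add: x_def n_def)
      show "a \<le> x i" using assms(1) by (simp add: x_def)
    qed
    have "\<bar>E b - E a\<bar> = \<bar>\<Sum>i<n. E (x (Suc i)) - E (x i)\<bar>"
      by (simp only: telescope)
    also have "\<dots> \<le> (\<Sum>i<n. \<bar>E (x (Suc i)) - E (x i)\<bar>)" by (rule sum_abs)
    also have "\<dots> \<le> (\<Sum>i<n. (r (x (Suc i)) - r (x i)) * ((b - a) / n))"
    proof (rule sum_mono)
      fix i assume i: "i \<in> {..<n}"
      have "x i \<le> x (Suc i)"
        using step[of i] assms(1) by (smt (verit) divide_nonneg_nonneg of_nat_0_le_iff)
      then show "\<bar>E (x (Suc i)) - E (x i)\<bar> \<le> (r (x (Suc i)) - r (x i)) * ((b - a) / n)"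
        using inc[of "x i" "x (Suc i)"] rng[of i] rng[of "Suc i"] i step[of i] by auto
    qed
    also have "\<dots> = (r b - r a) * ((b - a) / n)"
      by (simp only: sum_distrib_right[symmetric] telescope)
    finally show ?thesis by (simp add: n_def divide_inverse)
  qed
  have "(\<lambda>k. (r b - r a) * (b - a) * inverse (real (Suc k))) \<longlonglongrightarrow> (r b - r a) * (b - a) * 0"
    by (intro tendsto_mult tendsto_const LIMSEQ_inverse_real_of_nat)
  then have "\<bar>E b - E a\<bar> \<le> (r b - r a) * (b - a) * 0"
    using bound by (intro LIMSEQ_le_const) auto
  then show ?thesis by simp
qed

section \<open>The flux as the integral of its derivative\<close>

text \<open>In the application \<open>d\<close> comes from \<open>vector_derivative f\<close>,
  \<open>G\<close> from the entropy flux and \<open>H\<close> from the entropy conservative flux.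
  With \<open>F\<close> the integral of \<open>d\<close>, the error \<open>E\<close>, that is
  \<open>\<phi>\<close> minus \<open>F\<close>, takes equal values at \<open>a\<close> and
  \<open>b\<close>.\<close>

lemma has_integral_of_weighted_primitive:
  fixes v v' \<phi> d G :: "real \<Rightarrow> real" and H :: "real \<Rightarrow> real \<Rightarrow> real"
  assumes v: "\<And>x. (v has_real_derivative v' x) (at x)" "strict_mono v"
    and \<phi>: "continuous_on UNIV \<phi>"
    and G: "\<And>x y. x \<le> y \<Longrightarrow> ((\<lambda>w. v w * d w) has_integral G y - G x) {x..y}"
    and d: "\<And>w. w \<in> {a..b} \<Longrightarrow> \<bar>d w\<bar> \<le> B"
    and H: "\<And>x y. (v y - v x) * H x y = (v y * \<phi> y - G y) - (v x * \<phi> x - G x)"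
      "\<And>x. (H x \<longlongrightarrow> \<phi> x) (at x)"
    and "a \<le> b"
  shows "(d has_integral \<phi> b - \<phi> a) {a..b}"
proof -
  have contv: "continuous_on S v" for S
    using v(1) DERIV_isCont continuous_at_imp_continuous_on by blast
  have "d integrable_on {a..b}"
    using integrable_cancel_factor[of a b v d B] contv v(2) G[OF \<open>a \<le> b\<close>] d by blast
  then have int: "d integrable_on {s..t}" if "a \<le> s" "t \<le> b" for s t
    using integrable_subinterval_real that by (metis atLeastatMost_subset_iff)
  have "B \<ge> 0" using d[of a] \<open>a \<le> b\<close> by auto
  define F where "F x = integral {a..x} d" for x
  have F: "(d has_integral F t - F s) {s..t}" if "a \<le> s" "s \<le> t" "t \<le> b" for s t
  proof -
    have "F s + integral {s..t} d = F t"
      unfolding F_def using that int by (intro Henstock_Kurzweil_Integration.integral_combine) auto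
    then show ?thesis
      using int[of s t] that by (simp add: has_integral_iff algebra_simps)
  qed
  \<comment> \<open>With \<open>v\<close> frozen at an end point \<open>c\<close>, what remains is
    the integral of \<open>(v w - v c) * d w\<close>, bounded by the increment of \<open>v\<close>
    times \<open>B\<close> times the length. Both end points occur because the difference quotient
    at \<open>x\<close> below is two-sided.\<close>
  have near: "\<bar>G t - G s - v c * (F t - F s)\<bar> \<le> (v t - v s) * B * (t - s)"
    if st: "a \<le> s" "s \<le> t" "t \<le> b" and c: "c = s \<or> c = t" for s t c
  proof -
    have "((\<lambda>w. v w * d w - v c * d w) has_integral G t - G s - v c * (F t - F s)) (cbox s t)"
      using G F st by (intro has_integral_diff has_integral_mult_right) (auto simp: cbox_interval)
    moreover have "0 \<le> (v t - v s) * B"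
      using v(2) st \<open>B \<ge> 0\<close> by (simp add: strict_mono_less_eq)
    moreover have "norm (v w * d w - v c * d w) \<le> (v t - v s) * B" if w: "w \<in> cbox s t" for w
    proof -
      have "\<bar>v w - v c\<bar> \<le> v t - v s"
        using w c strict_mono_less_eq[OF v(2), of s w] strict_mono_less_eq[OF v(2), of w t]
        by (auto simp: cbox_interval)
      moreover have "\<bar>d w\<bar> \<le> B" using d w st by (auto simp: cbox_interval)
      ultimately have "\<bar>v w - v c\<bar> * \<bar>d w\<bar> \<le> (v t - v s) * B"
        by (intro mult_mono) auto
      then show ?thesis by (simp add: abs_mult[symmetric] algebra_simps)
    qed
    ultimately have "norm (G t - G s - v c * (F t - F s)) \<le> (v t - v s) * B * measure lborel (cbox s t)"
      by (intro has_integral_bound) auto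
    then show ?thesis using st by simp
  qed
  define E where "E x = \<phi> x - F x" for x
  have deriv0: "(E has_real_derivative 0) (at x)" if x: "x \<in> {a<..<b}" and vx: "v x \<noteq> 0" for x
  proof -
    \<comment> \<open>The sum of \<open>?A\<close> and \<open>?C\<close> is \<open>v x\<close> times
      the difference quotient of \<open>E\<close> at \<open>x\<close>. In \<open>?A\<close> the
      first factor tends to \<open>v' x\<close> and the second to 0, since \<open>H x y\<close> and
      \<open>\<phi> y\<close> both tend to \<open>\<phi> x\<close>; \<open>near\<close> makes
      \<open>?C\<close> small.\<close>
    let ?A = "\<lambda>y. (v y - v x) / (y - x) * (H x y - \<phi> y)"
    let ?C = "\<lambda>y. (G y - G x - v x * (F y - F x)) / (y - x)"
    have "(?A \<longlongrightarrow> v' x * (\<phi> x - \<phi> x)) (at x)"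
      using v(1)[of x] H(2)[of x] \<phi>
      by (intro tendsto_mult tendsto_diff) (auto simp: has_field_derivative_iff continuous_on_def)
    moreover have "(?C \<longlongrightarrow> 0) (at x)"
    proof (rule Lim_null_comparison)
      have "\<forall>\<^sub>F y in at x. y \<in> {a<..<b} - {x}"
        using x by (intro eventually_at_in_open) auto
      then show "\<forall>\<^sub>F y in at x. norm (?C y) \<le> \<bar>v y - v x\<bar> * B"
      proof (rule eventually_mono)
        fix y assume y: "y \<in> {a<..<b} - {x}"
        have "\<bar>G y - G x - v x * (F y - F x)\<bar> \<le> \<bar>v y - v x\<bar> * B * \<bar>y - x\<bar>"
        proof (cases "x \<le> y")
          case True
          then show ?thesis
            using near[of x y x] x y strict_mono_less_eq[OF v(2), of x y] by auto
        next
          case False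
          have "\<bar>G y - G x - v x * (F y - F x)\<bar> = \<bar>G x - G y - v x * (F x - F y)\<bar>"
            by (simp add: abs_if algebra_simps)
          then show ?thesis
            using False near[of y x x] x y strict_mono_less_eq[OF v(2), of y x] by auto
        qed
        then show "norm (?C y) \<le> \<bar>v y - v x\<bar> * B"
          using y by (simp add: abs_divide pos_divide_le_eq)
      qed
      have "((\<lambda>y. \<bar>v y - v x\<bar> * B) \<longlongrightarrow> \<bar>v x - v x\<bar> * B) (at x)"
        using DERIV_isCont[OF v(1)[of x]] by (intro tendsto_intros) (auto simp: isCont_def)
      then show "((\<lambda>y. \<bar>v y - v x\<bar> * B) \<longlongrightarrow> 0) (at x)" by simp
    qed
    ultimately have "((\<lambda>y. (?A y + ?C y) / v x) \<longlongrightarrow> (v' x * (\<phi> x - \<phi> x) + 0) / v x) (at x)"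
      using vx by (intro tendsto_divide tendsto_add) auto
    moreover have "\<forall>\<^sub>F y in at x. (?A y + ?C y) / v x = (E y - E x) / (y - x)"
      unfolding eventually_at
    proof (intro exI[of _ 1] conjI ballI impI)
      fix y assume "y \<noteq> x \<and> dist y x < 1"
      then have "y - x \<noteq> 0" by simp
      have "(v y - v x) * (H x y - \<phi> y) + (G y - G x - v x * (F y - F x)) = v x * (E y - E x)"
        unfolding right_diff_distrib H(1) by (simp add: E_def algebra_simps)
      moreover have "?A y + ?C y = ((v y - v x) * (H x y - \<phi> y) + (G y - G x - v x * (F y - F x))) / (y - x)"
        by (simp add: add_divide_distrib)
      ultimately show "(?A y + ?C y) / v x = (E y - E x) / (y - x)"
        using vx by simp
    qed simp
    ultimately show ?thesis
      by (simp add: has_field_derivative_iff tendsto_cong)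
  qed
  \<comment> \<open>Continuity of \<open>E\<close> lets the fundamental theorem of calculus pass
    over the possible zero of \<open>v\<close>.\<close>
  have "((\<lambda>_. 0) has_integral E b - E a) {a..b}"
  proof (rule fundamental_theorem_of_calculus_interior_strong)
    have "\<exists>z. {w. v w = 0} \<subseteq> {z}"
      using strict_mono_eq[OF v(2)] by (metis (mono_tags, lifting) mem_Collect_eq singleton_iff subsetI)
    then show "finite {w. v w = 0}"
      using finite_subset by blast
    show "(E has_vector_derivative 0) (at x)" if "x \<in> {a<..<b} - {w. v w = 0}" for x
      using deriv0[of x] that by (simp add: has_real_derivative_iff_has_vector_derivative)
    show "continuous_on {a..b} E"
      unfolding E_def F_def using continuous_on_subset[OF \<phi>] int[of a b]
      by (intro continuous_on_diff indefinite_integral_continuous_1) auto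
  qed fact
  then have "E b - E a = 0"
    using has_integral_0 has_integral_unique by blast
  moreover have "F a = 0" by (simp add: F_def)
  ultimately have "F b - F a = \<phi> b - \<phi> a" by (simp add: E_def)
  then show ?thesis
    using F[of a b] \<open>a \<le> b\<close> by simp
qed

section \<open>Subgradients of convex functions on the line\<close>

text \<open>The infimum of the slopes to the right of \<open>x\<close>, which is the right
  derivative, serves as \<open>r x\<close>. Unlike \<open>deriv \<eta>\<close>, it is meaningful
  also at kinks.\<close>

lemma convex_on_subgradient:
  fixes \<eta> :: "real \<Rightarrow> real"
  assumes "convex_on UNIV \<eta>"
  obtains r where "\<And>x y. \<eta> x + r x * (y - x) \<le> \<eta> y"
proof (rule that)
  show "\<eta> x + Inf ((\<lambda>t. (\<eta> x - \<eta> t) / (x - t)) ` ({x<..} \<inter> UNIV)) * (y - x) \<le> \<eta> y" for x y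
    using convex_le_Inf_differential[OF assms, of x y] by simp
qed

context
  fixes \<eta> r :: "real \<Rightarrow> real"
  assumes subgradient: "\<And>x y. \<eta> x + r x * (y - x) \<le> \<eta> y"
begin

text \<open>Adding the subgradient inequalities at \<open>x\<close> and at \<open>y\<close> gives
  \<open>(r x - r y) * (y - x) \<le> 0\<close>.\<close>

lemma subgradient_mono: "mono r"
proof
  fix x y :: real assume "x \<le> y"
  show "r x \<le> r y"
  proof (rule ccontr)
    assume "\<not> ?thesis"
    then have "(r x - r y) * (y - x) > 0"
      using \<open>x \<le> y\<close> by (cases "x = y") auto
    then show False
      using subgradient[of x y] subgradient[of y x] by (simp add: algebra_simps)
  qed
qed

text \<open>The increment of \<open>\<eta>\<close> and the integral of \<open>r\<close> over
  \<open>{x..y}\<close> both lie between \<open>r x * (y - x)\<close> and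
  \<open>r y * (y - x)\<close>, so their difference satisfies the hypothesis of
  \<open>eq_if_variation_le_monotone\<close>.\<close>

lemma subgradient_has_integral:
  assumes "a \<le> b"
  shows "(r has_integral \<eta> b - \<eta> a) {a..b}"
proof -
  have int: "r integrable_on {s..t}" for s t
    using integrable_on_mono_on subgradient_mono mono_on_subset by blast
  define E where "E x = \<eta> x - integral {a..x} r" for x
  have "E b = E a"
  proof (rule eq_if_variation_le_monotone[OF assms])
    fix x y assume xy: "a \<le> x" "x \<le> y" "y \<le> b"
    have "integral {a..x} r + integral {x..y} r = integral {a..y} r"
      using xy int by (intro Henstock_Kurzweil_Integration.integral_combine) auto
    then have E: "E y - E x = \<eta> y - \<eta> x - integral {x..y} r" by (simp add: E_def)
    have "r x * (y - x) \<le> integral {x..y} r"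
      using integral_le[of "\<lambda>_. r x" "{x..y}" r] int xy monoD[OF subgradient_mono, of x]
      by (auto simp: mult.commute)
    moreover have "integral {x..y} r \<le> r y * (y - x)"
      using integral_le[of r "{x..y}" "\<lambda>_. r y"] int xy monoD[OF subgradient_mono, of _ y]
      by (auto simp: mult.commute)
    ultimately show "\<bar>E y - E x\<bar> \<le> (r y - r x) * (y - x)"
      using E subgradient[of x y] subgradient[of y x] by (simp add: algebra_simps abs_le_iff)
  qed
  then show ?thesis
    using int[of a b] by (simp add: E_def has_integral_iff)
qed

text \<open>Difference quotients of \<open>\<eta>\<close> at \<open>x\<close> lie between
  \<open>r x\<close> and \<open>r y\<close>, so where \<open>r\<close> is continuous the derivative
  exists and equals \<open>r x\<close>. A monotone function has only countably many
  discontinuities.\<close>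

lemma negligible_deriv_neq_subgradient: "negligible {x. deriv \<eta> x \<noteq> r x}"
proof -
  have "(\<eta> has_real_derivative r x) (at x)" if "isCont r x" for x
    unfolding has_field_derivative_iff
  proof (rule Lim_null[THEN iffD2], rule Lim_null_comparison)
    show "\<forall>\<^sub>F y in at x. norm ((\<eta> y - \<eta> x) / (y - x) - r x) \<le> \<bar>r y - r x\<bar>"
      unfolding eventually_at
    proof (intro exI[of _ 1] conjI ballI impI)
      fix y assume "y \<noteq> x \<and> dist y x < 1"
      moreover have "\<bar>\<eta> y - \<eta> x - r x * (y - x)\<bar> \<le> (r y - r x) * (y - x)"
        using subgradient[of x y] subgradient[of y x] by (simp add: algebra_simps abs_le_iff)
      then have "\<bar>\<eta> y - \<eta> x - r x * (y - x)\<bar> \<le> \<bar>r y - r x\<bar> * \<bar>y - x\<bar>"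
        by (metis abs_ge_self abs_mult order_trans)
      moreover have "(\<eta> y - \<eta> x) / (y - x) - r x = (\<eta> y - \<eta> x - r x * (y - x)) / (y - x)"
        using calculation(1) by (simp add: diff_divide_distrib)
      ultimately show "norm ((\<eta> y - \<eta> x) / (y - x) - r x) \<le> \<bar>r y - r x\<bar>"
        by (simp add: abs_divide pos_divide_le_eq)
    qed simp
    have "((\<lambda>y. \<bar>r y - r x\<bar>) \<longlongrightarrow> \<bar>r x - r x\<bar>) (at x)"
      using that by (intro tendsto_intros) (auto simp: isCont_def)
    then show "((\<lambda>y. \<bar>r y - r x\<bar>) \<longlongrightarrow> 0) (at x)" by simp
  qed
  then have "{x. deriv \<eta> x \<noteq> r x} \<subseteq> {x. \<not> isCont r x}"
    using DERIV_imp_deriv by blast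
  then have "countable {x. deriv \<eta> x \<noteq> r x}"
    using countable_subset mono_ctble_discont[OF subgradient_mono] by blast
  then show ?thesis
    using null_sets_completionI[OF countable_imp_null_set_lborel] by (simp add: negligible_iff_null_sets)
qed

end

section \<open>Entropy inequality for Lax-Friedrichs intermediate states\<close>

lemma has_integral_le_negligible:
  fixes f g :: "real \<Rightarrow> real"
  assumes "(f has_integral i) S" "(g has_integral j) S" "negligible K"
    and "\<And>x. x \<in> S - K \<Longrightarrow> f x \<le> g x"
  shows "i \<le> j"
proof (rule has_integral_le)
  show "((\<lambda>x. if x \<in> K then g x else f x) has_integral i) S"
    by (rule has_integral_spike[OF assms(3) _ assms(1)]) auto
qed (use assms in auto)

text \<open>With \<^term>\<open>p\<close> a subgradient of \<^term>\<open>\<eta>\<close> at the intermediate state \<^term>\<open>x\<close>, the estimate is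
  \<open>\<integral>\<^sub>a\<^sup>b (\<eta>' - p) \<phi>' \<le> \<integral>\<^sub>a\<^sup>b \<bar>\<eta>' - p\<bar>\<close>, where \<open>\<eta>' - p\<close> changes its sign at \<^term>\<open>x\<close>.\<close>
lemma two_point_entropy_inequality:
  fixes \<eta> \<phi> d Q :: "real \<Rightarrow> real"
  assumes \<eta>: "convex_on UNIV \<eta>" and "a \<le> b"
    and d: "\<And>x y. x \<le> y \<Longrightarrow> (d has_integral \<phi> y - \<phi> x) {x..y}"
    and lip: "\<And>x y. x \<in> {a..b} \<Longrightarrow> y \<in> {a..b} \<Longrightarrow> \<bar>\<phi> y - \<phi> x\<bar> \<le> \<bar>y - x\<bar>"
    and Q: "\<And>x y. x \<le> y \<Longrightarrow> ((\<lambda>w. deriv \<eta> w * d w) has_integral Q y - Q x) {x..y}"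
  shows "\<eta> ((a + b) / 2 - (\<phi> b - \<phi> a) / 2) \<le> (\<eta> a + \<eta> b) / 2 - (Q b - Q a) / 2"
proof -
  obtain r where r: "\<And>x y. \<eta> x + r x * (y - x) \<le> \<eta> y"
    using convex_on_subgradient[OF \<eta>] by blast
  have mono: "mono r" using subgradient_mono[of \<eta> r] r by blast
  have "d integrable_on {x..y}" for x y
    using d[of x y] by (cases "x \<le> y") auto
  moreover have "\<bar>integral {x..y} d\<bar> \<le> 1 * (y - x)" if "a \<le> x" "x < y" "y \<le> b" for x y
    using integral_unique[OF d[of x y]] lip[of x y] that by auto
  ultimately obtain K where K: "negligible K" "\<And>x. x \<in> {a..b} - K \<Longrightarrow> \<bar>d x\<bar> \<le> 1"
    using ae_le_of_integral_le[of d a b 1] by blast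
  \<comment> \<open>On \<open>{a..b}\<close> off \<open>N\<close>, \<open>d\<close> is bounded by 1
    and \<open>deriv \<eta>\<close> agrees with the monotone \<open>r\<close>.\<close>
  define N where "N = K \<union> {x. deriv \<eta> x \<noteq> r x}"
  have N: "negligible N"
    unfolding N_def using K(1) negligible_deriv_neq_subgradient[of \<eta> r] r by (simp add: negligible_Un)
  define x where "x = (a + b) / 2 - (\<phi> b - \<phi> a) / 2"
  have x: "a \<le> x" "x \<le> b"
    using lip[of a b] \<open>a \<le> b\<close> by (auto simp: x_def field_simps abs_le_iff)
  define p where "p = r x"
  have lhs: "((\<lambda>w. deriv \<eta> w * d w - p * d w) has_integral Q t - Q s - p * (\<phi> t - \<phi> s)) {s..t}"
    if "s \<le> t" for s t
    using Q d that by (intro has_integral_diff has_integral_mult_right) auto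
  have rhs: "((\<lambda>w. r w - p) has_integral \<eta> t - \<eta> s - p * (t - s)) {s..t}" if "s \<le> t" for s t
    using has_integral_diff[OF subgradient_has_integral[of \<eta> r s t] has_integral_const_real[of p s t]] r that
    by (simp add: mult.commute)
  have pointwise: "deriv \<eta> w * d w - p * d w \<le> \<bar>r w - p\<bar>" if "w \<in> {a..b} - N" for w
  proof -
    have "\<bar>d w\<bar> \<le> 1" and "deriv \<eta> w = r w"
      using that K(2) by (auto simp: N_def)
    then have "\<bar>r w - p\<bar> * \<bar>d w\<bar> \<le> \<bar>r w - p\<bar>"
      by (simp add: mult_left_le)
    then show ?thesis
      using \<open>deriv \<eta> w = r w\<close> by (metis abs_ge_self abs_mult left_diff_distrib order_trans)
  qed
  have "Q x - Q a - p * (\<phi> x - \<phi> a) \<le> - (\<eta> x - \<eta> a - p * (x - a))"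
  proof (rule has_integral_le_negligible[OF lhs[OF x(1)] has_integral_neg[OF rhs[OF x(1)]] N])
    show "deriv \<eta> w * d w - p * d w \<le> - (r w - p)" if "w \<in> {a..x} - N" for w
      using pointwise[of w] that x monoD[OF mono, of w x] by (auto simp: p_def)
  qed
  moreover have "Q b - Q x - p * (\<phi> b - \<phi> x) \<le> \<eta> b - \<eta> x - p * (b - x)"
  proof (rule has_integral_le_negligible[OF lhs[OF x(2)] rhs[OF x(2)] N])
    show "deriv \<eta> w * d w - p * d w \<le> r w - p" if "w \<in> {x..b} - N" for w
      using pointwise[of w] that x monoD[OF mono, of x w] by (auto simp: p_def)
  qed
  \<comment> \<open>The choice of \<open>x\<close> enters here: when the two halves are added, all
    terms carrying \<open>p\<close> cancel.\<close>
  moreover have "\<phi> b - \<phi> a = a + b - 2 * x"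
    by (simp add: x_def field_simps)
  then have "p * (\<phi> b - \<phi> a) = p * (a + b - 2 * x)" by simp
  ultimately have "Q b - Q a \<le> \<eta> a + \<eta> b - 2 * \<eta> x"
    by (simp add: algebra_simps)
  then show ?thesis
    unfolding x_def[symmetric] by (simp add: field_simps)
qed

text \<open>States in reverse order are exchanged while \<open>\<phi>\<close>, \<open>d\<close> and
  \<open>Q\<close> change sign; this amounts to reversing the normal and leaves both sides
  unchanged.\<close>

lemma bar_state_entropy_inequality:
  fixes \<eta> \<phi> d Q :: "real \<Rightarrow> real"
  assumes \<eta>: "convex_on UNIV \<eta>" and ab: "a \<in> {m..M}" "b \<in> {m..M}"
    and d: "\<And>x y. x \<le> y \<Longrightarrow> (d has_integral \<phi> y - \<phi> x) {x..y}"
    and lip: "\<And>x y. x \<in> {m..M} \<Longrightarrow> y \<in> {m..M} \<Longrightarrow> \<bar>\<phi> y - \<phi> x\<bar> \<le> \<bar>y - x\<bar>"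
    and Q: "\<And>x y. x \<le> y \<Longrightarrow> ((\<lambda>w. deriv \<eta> w * d w) has_integral Q y - Q x) {x..y}"
  shows "\<eta> ((a + b) / 2 - (\<phi> b - \<phi> a) / 2) \<le> (\<eta> a + \<eta> b) / 2 - (Q b - Q a) / 2"
proof (cases "a \<le> b")
  case True
  then show ?thesis
    using ab lip by (intro two_point_entropy_inequality[OF \<eta> _ d _ Q]) auto
next
  case False
  have "\<eta> ((b + a) / 2 - (- \<phi> a - - \<phi> b) / 2) \<le> (\<eta> b + \<eta> a) / 2 - (- Q a - - Q b) / 2"
  proof (rule two_point_entropy_inequality[OF \<eta>])
    show "((\<lambda>w. - d w) has_integral - \<phi> y - - \<phi> x) {x..y}" if "x \<le> y" for x y
      using has_integral_neg[OF d[OF that]] by simp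
    show "((\<lambda>w. deriv \<eta> w * - d w) has_integral - Q y - - Q x) {x..y}" if "x \<le> y" for x y
      using has_integral_neg[OF Q[OF that]] by simp
    show "\<bar>- \<phi> y - - \<phi> x\<bar> \<le> \<bar>y - x\<bar>" if "x \<in> {b..a}" "y \<in> {b..a}" for x y
      using lip[of x y] that ab by auto
  qed (use False in auto)
  then show ?thesis by (simp add: algebra_simps)
qed

section \<open>The path between two states in the entropy variable, and averages along it\<close>

lemma pos_second_deriv:
  assumes "has_pos_second_deriv \<theta>"
  shows "(deriv \<theta> has_real_derivative deriv (deriv \<theta>) x) (at x)"
    and "continuous_on S (deriv \<theta>)" and "strict_mono (deriv \<theta>)"
proof -
  show *: "(deriv \<theta> has_real_derivative deriv (deriv \<theta>) x) (at x)" for x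
    using assms DERIV_deriv_iff_field_differentiable unfolding has_pos_second_deriv_def by blast
  then show "continuous_on S (deriv \<theta>)"
    using DERIV_isCont continuous_at_imp_continuous_on by blast
  show "strict_mono (deriv \<theta>)"
  proof
    fix x y :: real assume "x < y"
    then show "deriv \<theta> x < deriv \<theta> y"
      using DERIV_pos_imp_increasing[of x y "deriv \<theta>"] * assms
      unfolding has_pos_second_deriv_def by blast
  qed
qed

context
  fixes \<theta> :: "real \<Rightarrow> real"
  assumes \<theta>: "has_pos_second_deriv \<theta>"
begin

lemma inv_deriv_deriv: "inv (deriv \<theta>) (deriv \<theta> u) = u"
  using pos_second_deriv(3)[OF \<theta>] by (simp add: strict_mono_imp_inj_on)

lemma entropy_path_ends: "entropy_path \<theta> um up 0 = um" "entropy_path \<theta> um up 1 = up"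
  by (simp_all add: entropy_path_def inv_deriv_deriv)

lemma entropy_path_same: "entropy_path \<theta> u u s = u"
  by (simp add: entropy_path_def algebra_simps inv_deriv_deriv)

text \<open>\<open>deriv \<theta>\<close> need not be onto, so \<open>inv\<close> inverts it only on
  its range. By monotonicity the convex combination lies between the values at the two states, and
  the intermediate value theorem makes it the value at a point between them.\<close>

lemma range_entropy_path:
  assumes "s \<in> {0..1}"
  shows "entropy_path \<theta> um up s \<in> {min um up..max um up}"
    and "deriv \<theta> (entropy_path \<theta> um up s) = s * deriv \<theta> up + (1 - s) * deriv \<theta> um"
    (is "_ = ?c")
proof -
  have "min (deriv \<theta> um) (deriv \<theta> up) \<le> ?c" "?c \<le> max (deriv \<theta> um) (deriv \<theta> up)"
    using assms convex_bound_le[of "deriv \<theta> up" "max (deriv \<theta> um) (deriv \<theta> up)" "deriv \<theta> um" s "1 - s"]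
      convex_bound_le[of "- deriv \<theta> up" "- min (deriv \<theta> um) (deriv \<theta> up)" "- deriv \<theta> um" s "1 - s"]
    by auto
  moreover have "min (deriv \<theta> um) (deriv \<theta> up) = deriv \<theta> (min um up)"
    "max (deriv \<theta> um) (deriv \<theta> up) = deriv \<theta> (max um up)"
    using pos_second_deriv(3)[OF \<theta>] by (auto simp: min_def max_def strict_mono_less_eq)
  ultimately obtain w where w: "w \<in> {min um up..max um up}" "deriv \<theta> w = ?c"
    using IVT'[of "deriv \<theta>" "min um up" ?c "max um up"] pos_second_deriv(2)[OF \<theta>]
    by (metis atLeastAtMost_iff min.coboundedI1 max.cobounded1)
  then have "entropy_path \<theta> um up s = w"
    unfolding entropy_path_def using inv_deriv_deriv[of w] by simp
  then show "entropy_path \<theta> um up s \<in> {min um up..max um up}"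
    "deriv \<theta> (entropy_path \<theta> um up s) = ?c"
    using w by auto
qed

text \<open>On the compact interval between the states \<open>deriv \<theta>\<close> is a continuous
  injection, so its inverse is continuous on the image, where the argument of \<open>inv\<close>
  stays.\<close>

lemma continuous_entropy_path: "continuous_on {0..1} (entropy_path \<theta> um up)"
proof -
  let ?I = "{min um up..max um up}" and ?c = "\<lambda>s. s * deriv \<theta> up + (1 - s) * deriv \<theta> um"
  have "continuous_on (deriv \<theta> ` ?I) (inv (deriv \<theta>))"
    using pos_second_deriv(2)[OF \<theta>] by (intro continuous_on_inv) (auto simp: inv_deriv_deriv)
  moreover have "continuous_on {0..1} ?c" by (intro continuous_intros)
  moreover have "?c ` {0..1} \<subseteq> deriv \<theta> ` ?I"
    using range_entropy_path by (metis (no_types, lifting) image_eqI image_subsetI)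
  ultimately have "continuous_on {0..1} (\<lambda>s. inv (deriv \<theta>) (?c s))"
    by (rule continuous_on_compose2)
  then show ?thesis by (simp add: entropy_path_def[abs_def])
qed

text \<open>Multiplication by \<open>up - um\<close> clears the denominator in \<open>beta\<close>
  and covers equal states as well. In this form \<open>beta\<close> enters the bar state.\<close>

lemma beta_times_diff:
  "((\<lambda>s. (entropy_path \<theta> um up s - um) / 2) has_integral beta \<theta> um up * (up - um)) {0..1}"
proof (cases "up = um")
  case True
  then show ?thesis by (simp add: entropy_path_same)
next
  case False
  define g where "g s = (entropy_path \<theta> um up s - um) / (up - um)" for s
  have "g integrable_on {0..1}"
    unfolding g_def using False continuous_entropy_path by (intro integrable_continuous_real continuous_intros) auto
  then have "(g has_integral 2 * beta \<theta> um up) {0..1}"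
    using False by (simp add: beta_def g_def[abs_def, symmetric] has_integral_integral)
  from has_integral_mult_right[OF this, of "(up - um) / 2"]
  have "((\<lambda>s. (up - um) / 2 * g s) has_integral beta \<theta> um up * (up - um)) {0..1}"
    by (simp add: mult.commute)
  moreover have "(up - um) * g s = entropy_path \<theta> um up s - um" for s
    using False by (simp add: g_def)
  then have "(up - um) / 2 * g s = (entropy_path \<theta> um up s - um) / 2" for s
    by simp
  ultimately show ?thesis by simp
qed

text \<open>The path stays between the states, so for distinct states the integrand lies in
  \<open>{0..1}\<close>. It is continuous with value 1 at \<open>s = 1\<close>, so its integral
  cannot vanish. Equal states give 1/4.\<close>

lemma beta_bounds: "beta \<theta> um up \<in> {0<..1/2}"
proof (cases "up = um")
  case True
  have "((\<lambda>s::real. s) has_integral 1 / 2) {0..1}"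
    using ident_has_integral[of 0 "1::real"] by simp
  then show ?thesis
    using True by (simp add: beta_def integral_unique)
next
  case False
  define g where "g s = (entropy_path \<theta> um up s - um) / (up - um)" for s
  have cont: "continuous_on {0..1} g"
    unfolding g_def using False continuous_entropy_path by (intro continuous_intros) auto
  have g: "0 \<le> g s" "g s \<le> 1" if "s \<in> {0..1}" for s
  proof -
    have "entropy_path \<theta> um up s \<in> {min um up..max um up}"
      using range_entropy_path that by blast
    then show "0 \<le> g s" "g s \<le> 1"
      using False by (auto simp: g_def divide_le_eq zero_le_divide_iff min_def max_def split: if_splits)
  qed
  have beta: "beta \<theta> um up = integral {0..1} g / 2"
    using False by (simp add: beta_def g_def[abs_def])
  have "integral {0..1} g \<le> 1"
    using integral_le[of g "{0..1}" "\<lambda>_. 1"] g integrable_continuous_real[OF cont] by auto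
  moreover have "integral {0..1} g \<ge> 0"
    using integral_nonneg integrable_continuous_real[OF cont] g by blast
  moreover have "integral {0..1} g \<noteq> 0"
  proof
    assume "integral {0..1} g = 0"
    then have "g 1 = 0"
      using integral_eq_0_iff[OF cont] g by auto
    then show False using False by (simp add: g_def entropy_path_ends)
  qed
  ultimately show ?thesis unfolding beta by auto
qed

text \<open>Along the path the potential in direction \<open>n\<close> has derivative
  \<open>?V * (f (?w s) \<bullet> n)\<close>, and its total increment is
  \<open>?V * h um up n\<close> by entropy conservation; \<open>?V\<close> is nonzero for distinct
  states.\<close>

lemma entropy_conservative_flux_has_integral:
  fixes f g :: "real \<Rightarrow> real^'d"
  assumes "entropy_conservative_flux f \<theta> g h"
  shows "((\<lambda>s. f (entropy_path \<theta> um up s) \<bullet> n) has_integral h um up n) {0..1}"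
proof (cases "up = um")
  case True
  have "((\<lambda>s. f um \<bullet> n) has_integral f um \<bullet> n) {0..1::real}"
    using has_integral_const_real[of "f um \<bullet> n" 0 1] by simp
  then show ?thesis
    using True assms by (simp add: entropy_path_same entropy_conservative_flux_def)
next
  case False
  let ?w = "entropy_path \<theta> um up" and ?V = "deriv \<theta> up - deriv \<theta> um"
  define P where "P s = entropy_potential f \<theta> g (?w s) \<bullet> n" for s
  have h: "(deriv \<theta> y - deriv \<theta> x) * h x y n
      = (entropy_potential f \<theta> g y - entropy_potential f \<theta> g x) \<bullet> n" for x y
    using assms unfolding entropy_conservative_flux_def by blast
  have "((\<lambda>s. ?V * (f (?w s) \<bullet> n)) has_integral P 1 - P 0) {0..1}"
  proof (rule fundamental_theorem_of_calculus)
    fix s :: real assume s: "s \<in> {0..1}"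
    have "continuous_on UNIV (\<lambda>(x, y). h x y n)"
      using assms unfolding entropy_conservative_flux_def by blast
    moreover have "continuous_on {0..1} (\<lambda>t. (?w s, ?w t))"
      using continuous_entropy_path by (intro continuous_on_Pair continuous_on_const)
    ultimately have "continuous_on {0..1} (\<lambda>t. (\<lambda>(x, y). h x y n) (?w s, ?w t))"
      by (rule continuous_on_compose2) simp
    then have "((\<lambda>t. h (?w s) (?w t) n) \<longlongrightarrow> h (?w s) (?w s) n) (at s within {0..1})"
      using s by (simp add: continuous_on_def)
    moreover have "h (?w s) (?w s) n = f (?w s) \<bullet> n"
      using assms unfolding entropy_conservative_flux_def by blast
    ultimately have lim: "((\<lambda>t. ?V * h (?w s) (?w t) n) \<longlongrightarrow> ?V * (f (?w s) \<bullet> n)) (at s within {0..1})"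
      by (intro tendsto_mult tendsto_const) simp
    \<comment> \<open>The entropy variable is affine in the path parameter with slope
      \<open>?V\<close>, so dividing the conservation identity between \<open>?w s\<close> and
      \<open>?w t\<close> by \<open>t - s\<close> produces a difference quotient of
      \<open>P\<close>.\<close>
    have quotient: "?V * h (?w s) (?w t) n = (P t - P s) / (t - s)" if t: "t \<in> {0..1}" "t \<noteq> s" for t
    proof -
      have "deriv \<theta> (?w t) - deriv \<theta> (?w s) = (t - s) * ?V"
        using range_entropy_path(2) s t by (simp add: algebra_simps)
      then have "(t - s) * ?V * h (?w s) (?w t) n = P t - P s"
        using h[of "?w t" "?w s"] by (simp add: P_def inner_diff_left)
      then show ?thesis using t by (simp add: field_simps)
    qed
    have "((\<lambda>t. (P t - P s) / (t - s)) \<longlongrightarrow> ?V * (f (?w s) \<bullet> n)) (at s within {0..1})"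
      by (rule Lim_transform_within[OF lim zero_less_one]) (use quotient in auto)
    then show "(P has_vector_derivative ?V * (f (?w s) \<bullet> n)) (at s within {0..1})"
      by (simp add: has_real_derivative_iff_has_vector_derivative[symmetric] has_field_derivative_iff)
  qed simp
  moreover have "P 1 - P 0 = ?V * h um up n"
    using h by (simp add: P_def entropy_path_ends inner_diff_left)
  moreover have "?V \<noteq> 0"
    using False strict_mono_eq[OF pos_second_deriv(3)[OF \<theta>]] by simp
  ultimately show ?thesis
    by (simp add: has_integral_mult_right_iff)
qed

end

section \<open>The bar state as an average along the path\<close>

lemma flux_lip_bound:
  fixes f :: "real \<Rightarrow> real^'d"
  assumes "flux_lip f m M \<le> ereal \<alpha>" "x \<in> {m..M}" "y \<in> {m..M}" "norm u = 1"
  shows "\<bar>(f y - f x) \<bullet> u\<bar> \<le> \<alpha> * \<bar>y - x\<bar>"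
proof (cases "y = x")
  case False
  have "ereal (\<bar>(f y - f x) \<bullet> u\<bar> / \<bar>y - x\<bar>)
      \<le> (SUP n \<in> sphere 0 1. ereal (\<bar>(f y - f x) \<bullet> n\<bar> / \<bar>y - x\<bar>))"
    using assms(4) by (intro SUP_upper) simp
  also have "\<dots> \<le> flux_lip f m M"
    unfolding flux_lip_def using False assms by (intro SUP_upper2[of "(y, x)"]) auto
  also note assms(1)
  finally show ?thesis
    using False by (simp add: pos_divide_le_eq)
qed simp

theorem lemma2p1:
  fixes f g q :: "real \<Rightarrow> real^'d"
    and \<theta> \<eta> :: "real \<Rightarrow> real"
    and h :: "real \<Rightarrow> real \<Rightarrow> real^'d \<Rightarrow> real"
    and m M um up \<alpha> :: real
    and n :: "real^'d"
  assumes "locally_lipschitz f"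
    and "m \<le> M"
    and "entropy_pair f \<theta> g"
    and "has_pos_second_deriv \<theta>"
    and "entropy_conservative_flux f \<theta> g h"
    and "um \<in> {m..M}" and "up \<in> {m..M}"
    and "n \<noteq> 0"
    and "\<alpha> > 0" and "flux_lip f m M \<le> ereal \<alpha>"
    and "convex_entropy_pair f \<eta> q"
  shows "m \<le> bar_state f \<theta> h \<alpha> um up n \<and> bar_state f \<theta> h \<alpha> um up n \<le> M
    \<and> \<eta> (bar_state f \<theta> h \<alpha> um up n)
        \<le> (\<eta> um + eta_bar \<theta> \<eta> um up) / 2 - (q_ec \<theta> q um up n - q um \<bullet> n) / (2 * \<alpha> * norm n)
    \<and> beta \<theta> um up \<in> {0<..1/2}"
proof -
  \<comment> \<open>\<open>N\<close> absorbs \<open>\<alpha> * norm n\<close>, so that the flux in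
    this direction has Lipschitz constant 1 on \<open>{m..M}\<close>, as the two-point estimate
    requires.\<close>
  define N where "N = n /\<^sub>R (\<alpha> * norm n)"
  have \<alpha>n: "\<alpha> * norm n > 0" using assms by simp
  define \<phi> d Q where "\<phi> w = f w \<bullet> N" and "d w = vector_derivative f (at w) \<bullet> N" and "Q w = q w \<bullet> N" for w
  let ?w = "entropy_path \<theta> um up" and ?x = "bar_state f \<theta> h \<alpha> um up n"
  note v = pos_second_deriv[OF assms(4)]
  have \<eta>: "convex_on UNIV \<eta>" and q: "entropy_pair f \<eta> q"
    using assms by (auto simp: convex_entropy_pair_def)
  have cont\<phi>: "continuous_on UNIV \<phi>"
    unfolding \<phi>_def using locally_lipschitz_imp_continuous[OF assms(1)] by (intro continuous_intros)
  have pair: "((\<lambda>w. deriv \<zeta> w * d w) has_integral p y \<bullet> N - p x \<bullet> N) {x..y}"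
    if "entropy_pair f \<zeta> p" "x \<le> y" for \<zeta> x y and p :: "real \<Rightarrow> real^'d"
  proof -
    have "((\<lambda>w. deriv \<zeta> w *\<^sub>R vector_derivative f (at w)) has_integral p y - p x) {x..y}"
      using that unfolding entropy_pair_def by blast
    from has_integral_linear[OF this bounded_linear_inner_left[of N]] show ?thesis
      by (simp add: d_def comp_def inner_diff_left)
  qed
  have lip: "\<bar>\<phi> y - \<phi> x\<bar> \<le> \<bar>y - x\<bar>" if "x \<in> {m..M}" "y \<in> {m..M}" for x y
  proof -
    have "\<bar>(f y - f x) \<bullet> (n /\<^sub>R norm n)\<bar> \<le> \<alpha> * \<bar>y - x\<bar>"
      using that assms by (intro flux_lip_bound) auto
    moreover have "(f y - f x) \<bullet> (n /\<^sub>R norm n) = \<alpha> * (\<phi> y - \<phi> x)"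
      using assms by (simp add: \<phi>_def N_def inner_diff_left field_simps)
    ultimately have "\<alpha> * \<bar>\<phi> y - \<phi> x\<bar> \<le> \<alpha> * \<bar>y - x\<bar>"
      using \<open>\<alpha> > 0\<close> by (metis abs_mult abs_of_pos)
    then show ?thesis using \<open>\<alpha> > 0\<close> by simp
  qed
  have ec: "(deriv \<theta> y - deriv \<theta> x) * h x y N
      = (deriv \<theta> y * \<phi> y - g y \<bullet> N) - (deriv \<theta> x * \<phi> x - g x \<bullet> N)" for x y
  proof -
    have "(deriv \<theta> y - deriv \<theta> x) * h x y N
        = (entropy_potential f \<theta> g y - entropy_potential f \<theta> g x) \<bullet> N"
      using assms(5) unfolding entropy_conservative_flux_def by blast
    then show ?thesis
      by (simp add: entropy_potential_def \<phi>_def inner_diff_left)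
  qed
  have h_lim: "((\<lambda>y. h x y N) \<longlongrightarrow> \<phi> x) (at x)" for x
  proof -
    have "continuous_on UNIV (\<lambda>(x, y). h x y N)"
      using assms(5) unfolding entropy_conservative_flux_def by blast
    then have "continuous_on UNIV (\<lambda>y. (\<lambda>(x, y). h x y N) (x, y))"
      by (rule continuous_on_compose2) (auto intro!: continuous_on_Pair continuous_on_const continuous_on_id)
    then have "((\<lambda>y. h x y N) \<longlongrightarrow> h x x N) (at x)"
      by (simp add: continuous_on_def)
    moreover have "h x x N = \<phi> x"
      using assms(5) unfolding entropy_conservative_flux_def \<phi>_def by blast
    ultimately show ?thesis by simp
  qed
  \<comment> \<open>The weighted primitive result is applied with \<open>deriv \<theta>\<close> as
    \<open>v\<close>, \<open>g\<close> in direction \<open>N\<close> as \<open>G\<close> and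
    \<open>h\<close> in direction \<open>N\<close> as \<open>H\<close>; local Lipschitz continuity
    provides \<open>B\<close>.\<close>
  have d: "(d has_integral \<phi> y - \<phi> x) {x..y}" if xy: "x \<le> y" for x y
  proof -
    obtain B where "\<And>w. w \<in> {x..y} \<Longrightarrow> \<bar>d w\<bar> \<le> B"
      unfolding d_def using vector_derivative_inner_bounded[OF assms(1)] by blast
    then show ?thesis
      using has_integral_of_weighted_primitive[OF v(1,3) cont\<phi> pair[OF assms(3)] _ ec h_lim xy] by blast
  qed
  have w: "?w s \<in> {m..M}" if "s \<in> {0..1}" for s
    using range_entropy_path(1)[OF assms(4) that, of um up] assms by auto
  note cont_w = continuous_entropy_path[OF assms(4), of um up]
  have half_diff: "(X / (\<alpha> * norm n) - Y / (\<alpha> * norm n)) / 2 = (X - Y) / (2 * \<alpha> * norm n)" for X Y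
    by (simp add: diff_divide_distrib ac_simps)
  define U where "U s = (um + ?w s) / 2 - (\<phi> (?w s) - \<phi> um) / 2" for s
  have U: "(U has_integral ?x) {0..1}"
  proof -
    \<comment> \<open>Splitting \<open>U s\<close> this way separates the average that yields
      \<open>beta\<close> from the average of \<open>\<phi>\<close> that yields
      \<open>h um up N\<close>; linearity in the normal then turns \<open>N\<close> back into
      \<open>n\<close>.\<close>
    have int: "((\<lambda>s. um + (?w s - um) / 2 - (\<phi> (?w s) - \<phi> um) / 2)
        has_integral um + beta \<theta> um up * (up - um) - (h um up N - \<phi> um) / 2) {0..1}"
      using has_integral_const_real[of um 0 1] has_integral_const_real[of "\<phi> um" 0 1]
        beta_times_diff[OF assms(4)] entropy_conservative_flux_has_integral[OF assms(4,5)]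
      unfolding \<phi>_def by (intro has_integral_diff has_integral_add has_integral_divide) auto
    moreover have "h um up N = h um up n / (\<alpha> * norm n)"
    proof -
      have "linear (h um up)"
        using assms(5) unfolding entropy_conservative_flux_def by blast
      then show ?thesis
        by (simp add: N_def linear_scale divide_inverse_commute)
    qed
    moreover have "\<phi> um = f um \<bullet> n / (\<alpha> * norm n)"
      by (simp add: \<phi>_def N_def divide_inverse_commute)
    ultimately have "um + beta \<theta> um up * (up - um) - (h um up N - \<phi> um) / 2 = ?x"
      by (simp add: half_diff bar_state_def algebra_simps)
    moreover have "U = (\<lambda>s. um + (?w s - um) / 2 - (\<phi> (?w s) - \<phi> um) / 2)"
      by (simp add: U_def fun_eq_iff field_simps)
    ultimately show ?thesis using int by simp
  qed
  \<comment> \<open>Since \<open>\<phi>\<close> is 1-Lipschitz, \<open>U s\<close> lies between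
    \<open>um\<close> and \<open>?w s\<close>.\<close>
  have U_range: "U s \<in> {m..M}" if "s \<in> {0..1}" for s
    using lip[of um "?w s"] w[OF that] assms(6) by (auto simp: U_def field_simps abs_if split: if_splits)
  have "m \<le> ?x"
    using has_integral_le[OF has_integral_const_real[of m 0 1] U] U_range by simp
  moreover have "?x \<le> M"
    using has_integral_le[OF U has_integral_const_real[of M 0 1]] U_range by simp
  moreover have "\<eta> ?x \<le> (\<eta> um + eta_bar \<theta> \<eta> um up) / 2 - (q_ec \<theta> q um up n - q um \<bullet> n) / (2 * \<alpha> * norm n)"
  proof -
    \<comment> \<open>Regularity of \<open>q\<close> comes from its being a primitive; it makes
      \<open>q\<close> integrable along the path.\<close>
    have contQ: "continuous_on {m..M} Q"
    proof -
      have eq: "Q y = Q m + integral {m..y} (\<lambda>w. deriv \<eta> w * d w)" if "y \<in> {m..M}" for y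
        using integral_unique[OF pair[OF q, of m y]] that by (simp add: Q_def)
      have "continuous_on {m..M} (\<lambda>y. Q m + integral {m..y} (\<lambda>w. deriv \<eta> w * d w))"
        using pair[OF q \<open>m \<le> M\<close>] by (intro continuous_intros indefinite_integral_continuous_1) blast
      then show ?thesis by (rule continuous_on_eq) (rule eq[symmetric])
    qed
    have "?w ` {0..1} \<subseteq> {m..M}" using w by blast
    then have "continuous_on {0..1} (\<lambda>s. Q (?w s))" "continuous_on {0..1} (\<lambda>s. \<eta> (?w s))"
      using continuous_on_compose2[OF contQ cont_w]
        continuous_on_compose2[OF convex_on_continuous[OF open_UNIV \<eta>] cont_w] by blast+
    then have int: "((\<lambda>s. Q (?w s)) has_integral integral {0..1} (\<lambda>s. Q (?w s))) {0..1}"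
      "((\<lambda>s. \<eta> (?w s)) has_integral eta_bar \<theta> \<eta> um up) {0..1}"
      unfolding eta_bar_def by (blast intro: integrable_integral integrable_continuous_real)+
    have Q_eq: "Q y = q y \<bullet> n / (\<alpha> * norm n)" for y
      by (simp add: Q_def N_def divide_inverse_commute)
    then have "\<alpha> * norm n * Q y = q y \<bullet> n" for y
      using \<alpha>n by auto
    then have "q_ec \<theta> q um up n = integral {0..1} (\<lambda>s. \<alpha> * norm n * Q (?w s))"
      by (simp add: q_ec_def)
    then have q_ec: "integral {0..1} (\<lambda>s. Q (?w s)) = q_ec \<theta> q um up n / (\<alpha> * norm n)"
      using \<alpha>n by auto
    have rhs: "((\<lambda>s. (\<eta> um + \<eta> (?w s)) / 2 - (Q (?w s) - Q um) / 2)
        has_integral (\<eta> um + eta_bar \<theta> \<eta> um up) / 2 - (q_ec \<theta> q um up n / (\<alpha> * norm n) - Q um) / 2) {0..1}"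
      using int has_integral_const_real[of "\<eta> um" 0 1] has_integral_const_real[of "Q um" 0 1]
      unfolding q_ec by (intro has_integral_diff has_integral_add has_integral_divide) auto
    obtain r where r: "\<And>x y. \<eta> x + r x * (y - x) \<le> \<eta> y"
      using convex_on_subgradient[OF \<eta>] by blast
    \<comment> \<open>Jensen's inequality through the supporting line of \<open>\<eta>\<close> at
      \<open>?x\<close>: its average along \<open>U\<close> is \<open>\<eta> ?x\<close>, because
      \<open>U\<close> has mean \<open>?x\<close>. The line is compared pointwise with the
      right-hand side.\<close>
    have "((\<lambda>s. \<eta> ?x + r ?x * (U s - ?x)) has_integral \<eta> ?x + r ?x * (?x - ?x)) {0..1}"
      using U has_integral_const_real[of "\<eta> ?x" 0 1] has_integral_const_real[of ?x 0 1]
      by (intro has_integral_diff has_integral_add has_integral_mult_right) auto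
    then have "\<eta> ?x + r ?x * (?x - ?x)
        \<le> (\<eta> um + eta_bar \<theta> \<eta> um up) / 2 - (q_ec \<theta> q um up n / (\<alpha> * norm n) - Q um) / 2"
    proof (rule has_integral_le[OF _ rhs])
      fix s :: real assume s: "s \<in> {0..1}"
      have "\<eta> (U s) \<le> (\<eta> um + \<eta> (?w s)) / 2 - (Q (?w s) - Q um) / 2"
        unfolding U_def using pair[OF q] d lip assms(6) w[OF s]
        by (intro bar_state_entropy_inequality[OF \<eta>]) (auto simp: Q_def)
      then show "\<eta> ?x + r ?x * (U s - ?x) \<le> (\<eta> um + \<eta> (?w s)) / 2 - (Q (?w s) - Q um) / 2"
        using r[of ?x "U s"] by linarith
    qed
    then show ?thesis by (simp add: half_diff Q_eq)
  qed
  moreover note beta_bounds[OF assms(4), of um up]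
  ultimately show ?thesis by (intro conjI)
qed

end
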